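(* Let $G$ be the free group on $X=\{x_1,x_2\}$. Then for every $\alpha(n)\in\mathcal{CG}$ there exists an essential subgroup $H$ of $G$ such that $\Gamma_{G/H}(n)\sim\alpha(n)$.
   Context: The class $\mathcal{CG}$ consists of all functions $\alpha:\mathbf{N}\cup\{0\}\to\mathbf{N}$ of the form $\alpha(n)=\sum_{i=0}^n f_i$, where $(f_i)_{i\ge 0}$ is a sequence such that: (i) $f_0=1$ and there is some $r$ with $0\le r\le\infty$ such that $f_i=0$ for $i>r$ and $f_i$ is a positive integer for all other $i$ (if $r=\infty$, all $f_i$ are positive integers); (ii) there exists $d>0$ such that $f_{i+1}\le d f_i$ for every $i\ge 0$. A subgroup $H$ of a group $G$ is essential if it intersects non-trivially every non-trivial subgroup of $G$. For $g\in G$, $l(g)$ denotes the word length of $g$ with respect to $X\cup X^{-1}$. For a subgroup $H$ of $G$, the cogrowth function $\Gamma_{G/H}(n)$ is the growth function of a complete set $T$ of right coset representatives for $H$ in $G$ in which every representative is of minimal length in its coset: $\Gamma_{G/H}(n)=\mathrm{card}\{t\in T\mid l(t)\le n\}$. (Equivalently, it is the number of right cosets $Hg$ containing an element of length at most $n$.) For functions $\Gamma_1,\Gamma_2$ on the non-negative integers, $\Gamma_1(n)\sim\Gamma_2(n)$ means that there exists a positive integer $C$ such that $\Gamma_1(n)\le\Gamma_2(Cn)$ and $\Gamma_2(n)\le\Gamma_1(Cn)$ for all $n\ge 0$. *)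

theory Defs
  imports "HOL-Algebra.Coset" "HOL-Library.Extended_Nat" Complex_Main
begin

section \<open>The free group on a set, as the group of reduced words\<close>

text \<open>The letter \<open>(False, x)\<close> stands for the generator \<open>x\<close> and \<open>(True, x)\<close> for its formal inverse.\<close>

type_synonym 'a letter = "bool \<times> 'a"

definition inv_letter :: "'a letter \<Rightarrow> 'a letter" where
  "inv_letter a = (\<not> fst a, snd a)"

fun reduced :: "'a letter list \<Rightarrow> bool" where
  "reduced (a # b # w) \<longleftrightarrow> b \<noteq> inv_letter a \<and> reduced (b # w)"
| "reduced _ \<longleftrightarrow> True"

fun push :: "'a letter \<Rightarrow> 'a letter list \<Rightarrow> 'a letter list" where
  "push a [] = [a]"
| "push a (b # w) = (if b = inv_letter a then w else a # b # w)"

definition reduce :: "'a letter list \<Rightarrow> 'a letter list" where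
  "reduce w = foldr push w []"

definition free_group :: "'a set \<Rightarrow> 'a letter list monoid" where
  "free_group X =
     \<lparr>carrier = {w. reduced w \<and> snd ` set w \<subseteq> X},
      mult = (\<lambda>u v. reduce (u @ v)),
      one = []\<rparr>"

definition free_gen :: "'a \<Rightarrow> 'a letter list" where
  "free_gen x = [(False, x)]"

lemma inv_letter_simps [simp]:
  "inv_letter (inv_letter a) = a" "inv_letter a \<noteq> a" "a \<noteq> inv_letter a"
  "snd (inv_letter a) = snd a" "(inv_letter a = inv_letter b) = (a = b)"
  by (auto simp: inv_letter_def prod_eq_iff)

lemma reduced_ConsD: "reduced (a # w) \<Longrightarrow> reduced w"
  by (cases w) auto

lemma reduced_push: "reduced w \<Longrightarrow> reduced (push a w)"
  by (cases w) (auto dest: reduced_ConsD)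

lemma push_push_inv:
  assumes "reduced w" shows "push a (push (inv_letter a) w) = w"
proof (cases w)
  case (Cons b w')
  then show ?thesis using assms by (cases w') auto
qed auto

lemma push_reduced: "reduced (a # w) \<Longrightarrow> push a w = a # w"
  by (cases w) auto

lemma reduced_foldr: "reduced v \<Longrightarrow> reduced (foldr push u v)"
  by (induction u) (auto intro: reduced_push)

lemma reduced_reduce: "reduced (reduce w)"
  by (simp add: reduce_def reduced_foldr)

lemma reduce_reduced: "reduced w \<Longrightarrow> reduce w = w"
proof (induction w)
  case (Cons a w)
  then have "foldr push w [] = w"
    by (auto simp: reduce_def dest: reduced_ConsD)
  then show ?case
    using push_reduced[OF Cons.prems] by (simp add: reduce_def)
qed (simp add: reduce_def)

lemma foldr_push:
  assumes "reduced u" "reduced v" shows "foldr push (push a u) v = push a (foldr push u v)"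
proof (cases u)
  case (Cons b u')
  then show ?thesis
    using push_push_inv[of "foldr push u' v" a] reduced_foldr[OF assms(2), of u'] by auto
qed auto

lemma foldr_push_reduce:
  assumes "reduced v" shows "foldr push (reduce u) v = foldr push u v"
  using assms
  by (induction u) (auto simp: reduce_def foldr_push reduced_foldr)

lemma set_push: "set (push a w) \<subseteq> insert a (set w)"
  by (cases w) auto

lemma set_foldr_push: "set (foldr push u v) \<subseteq> set u \<union> set v"
  by (induction u) (use set_push in fastforce)+

lemma reduce_append: "reduced v \<Longrightarrow> reduce (u @ v) = foldr push u v"
  using reduce_reduced[of v] by (simp add: reduce_def)

lemma group_free_group: "group (free_group X)"
proof (rule groupI)
  fix u v assume "u \<in> carrier (free_group X)" "v \<in> carrier (free_group X)"
  then show "u \<otimes>\<^bsub>free_group X\<^esub> v \<in> carrier (free_group X)"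
    using set_foldr_push[of u v]
    by (auto simp: free_group_def reduced_reduce reduced_foldr reduce_append image_subset_iff)
next
  fix u v w
  assume "u \<in> carrier (free_group X)" "v \<in> carrier (free_group X)" "w \<in> carrier (free_group X)"
  then have red: "reduced v" "reduced w" by (auto simp: free_group_def)
  have "reduce (reduce (u @ v) @ w) = foldr push (u @ v) w"
    unfolding reduce_append[OF red(2)] foldr_push_reduce[OF red(2)] ..
  also have "\<dots> = reduce (u @ reduce (v @ w))"
    using red by (simp add: reduce_append reduced_foldr)
  finally show "u \<otimes>\<^bsub>free_group X\<^esub> v \<otimes>\<^bsub>free_group X\<^esub> w
      = u \<otimes>\<^bsub>free_group X\<^esub> (v \<otimes>\<^bsub>free_group X\<^esub> w)"
    by (simp add: free_group_def)
next
  fix u assume u: "u \<in> carrier (free_group X)"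
  define v where "v = rev (map inv_letter u)"
  have "foldr push (rev (map inv_letter s)) (foldr push s t) = t" if "reduced t" for s t :: "'a letter list"
    using that
  proof (induction s)
    case (Cons a s)
    then show ?case
      using push_push_inv[of "foldr push s t" "inv_letter a"] by (simp add: reduced_foldr)
  qed simp
  from this[of "[]" u] have "foldr push v u = []"
    using u by (simp add: v_def free_group_def reduce_reduced reduce_def[symmetric])
  then have "foldr push (reduce v) u = []"
    using u by (simp add: free_group_def foldr_push_reduce)
  moreover have "reduce v \<in> carrier (free_group X)"
    using u set_foldr_push[of v "[]"]
    by (fastforce simp: free_group_def reduced_reduce v_def reduce_def[symmetric] image_subset_iff)
  ultimately show "\<exists>y\<in>carrier (free_group X). y \<otimes>\<^bsub>free_group X\<^esub> u = \<one>\<^bsub>free_group X\<^esub>"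
    using u by (intro bexI[of _ "reduce v"]) (auto simp: free_group_def reduce_append)
qed (auto simp: free_group_def reduce_reduced)


section \<open>Word length\<close>

text \<open>Elements outside the subgroup generated by \<open>X\<close> get an unspecified length.\<close>

definition word_length :: "('a, 'b) monoid_scheme \<Rightarrow> 'a set \<Rightarrow> 'a \<Rightarrow> nat" where
  "word_length G X g =
     (LEAST n. \<exists>ws. set ws \<subseteq> X \<union> m_inv G ` X \<and> length ws = n \<and> foldr (mult G) ws (one G) = g)"

lemma inv_free_gen:
  assumes "x \<in> X" shows "m_inv (free_group X) (free_gen x) = [(True, x)]"
proof -
  interpret group "free_group X" by (rule group_free_group)
  show ?thesis
    by (rule inv_equality)
      (use assms in \<open>auto simp: free_group_def free_gen_def reduce_def inv_letter_def\<close>)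
qed

lemma letters_free_group:
  "free_gen ` X \<union> m_inv (free_group X) ` (free_gen ` X) = (\<lambda>a. [a]) ` (UNIV \<times> X)"
proof -
  have "m_inv (free_group X) ` (free_gen ` X) = (\<lambda>x. [(True, x)]) ` X"
    by (auto simp: inv_free_gen image_iff)
  moreover have "UNIV \<times> X = Pair False ` X \<union> Pair True ` X"
    by auto
  ultimately show ?thesis
    by (auto simp: free_gen_def)
qed

lemma foldr_mult_free_group:
  "foldr (mult (free_group X)) (map (\<lambda>a. [a]) w) (one (free_group X)) = reduce w"
proof (induction w)
  case (Cons a w)
  then show ?case
    using reduce_append[OF reduced_reduce, of "[a]" w]
    by (simp add: free_group_def) (simp add: reduce_def)
qed (simp add: free_group_def reduce_def)

lemma length_reduce: "length (reduce w) \<le> length w"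
proof (induction w)
  case (Cons a w)
  have "length (push a u) \<le> Suc (length u)" for u by (cases u) auto
  from this[of "reduce w"] Cons show ?case by (simp add: reduce_def)
qed (simp add: reduce_def)

lemma word_length_free_group:
  assumes "g \<in> carrier (free_group X)"
  shows "word_length (free_group X) (free_gen ` X) g = length g"
  unfolding word_length_def
proof (rule Least_equality)
  have "set (map (\<lambda>a. [a]) g) \<subseteq> (\<lambda>a. [a]) ` (UNIV \<times> X)"
    using assms by (force simp: free_group_def)
  moreover have "foldr (mult (free_group X)) (map (\<lambda>a. [a]) g) (one (free_group X)) = g"
    using assms by (simp only: foldr_mult_free_group) (simp add: reduce_reduced free_group_def)
  ultimately show "\<exists>ws. set ws \<subseteq> free_gen ` X \<union> m_inv (free_group X) ` free_gen ` X \<and>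
      length ws = length g \<and> foldr (mult (free_group X)) ws (one (free_group X)) = g"
    unfolding letters_free_group by (metis length_map)
next
  fix n
  assume "\<exists>ws. set ws \<subseteq> free_gen ` X \<union> m_inv (free_group X) ` free_gen ` X \<and>
      length ws = n \<and> foldr (mult (free_group X)) ws (one (free_group X)) = g"
  then obtain ws where ws: "set ws \<subseteq> (\<lambda>a. [a]) ` (UNIV \<times> X)" "length ws = n"
    "foldr (mult (free_group X)) ws (one (free_group X)) = g"
    unfolding letters_free_group by blast
  have "map (\<lambda>a. [a]) (map hd ws) = ws"
    using ws(1) by (induction ws) auto
  then have "g = reduce (map hd ws)"
    using ws(3) foldr_mult_free_group[of X "map hd ws"] by simp
  then show "length g \<le> n"
    using length_reduce[of "map hd ws"] ws(2) by simp
qed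

text \<open>Existence, and uniqueness on the carrier, of the extension of \<open>f\<close> to a homomorphism.\<close>

lemma free_group_universal:
  assumes "group K" and f: "f \<in> X \<rightarrow> carrier K"
  shows "\<exists>h \<in> hom (free_group X) K. (\<forall>x\<in>X. h (free_gen x) = f x) \<and>
     (\<forall>h' \<in> hom (free_group X) K. (\<forall>x\<in>X. h' (free_gen x) = f x) \<longrightarrow>
        (\<forall>w \<in> carrier (free_group X). h' w = h w))"
proof -
  interpret K: group K by fact
  interpret F: group "free_group X" by (rule group_free_group)
  define e where "e a = (if fst a then inv\<^bsub>K\<^esub> (f (snd a)) else f (snd a))" for a
  define h where "h w = foldr (\<lambda>a k. e a \<otimes>\<^bsub>K\<^esub> k) w \<one>\<^bsub>K\<^esub>" for w
  have e: "e a \<in> carrier K" if "snd a \<in> X" for a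
    using f that by (auto simp: e_def)
  have h_closed: "h w \<in> carrier K" if "snd ` set w \<subseteq> X" for w
    using that by (induction w) (auto simp: h_def e)
  have e_inv: "e (inv_letter a) = inv\<^bsub>K\<^esub> e a" if "snd a \<in> X" for a
  proof -
    have "f (snd a) \<in> carrier K" using f that by blast
    then show ?thesis by (simp add: e_def inv_letter_def)
  qed
  have h_push: "h (push a w) = e a \<otimes>\<^bsub>K\<^esub> h w" if "snd a \<in> X" "snd ` set w \<subseteq> X" for a w
  proof (cases w)
    case (Cons b w')
    then show ?thesis
      using that h_closed[of w'] e[of a] e_inv[of a]
      by (auto simp: h_def K.m_assoc[symmetric])
  qed (auto simp: h_def)
  have h_foldr: "h (foldr push u v) = h u \<otimes>\<^bsub>K\<^esub> h v"
    if "snd ` set u \<subseteq> X" "snd ` set v \<subseteq> X" for u v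
    using that
  proof (induction u)
    case Nil
    then show ?case using h_closed by (simp add: h_def[of "[]"])
  next
    case (Cons a u)
    have "snd ` set (foldr push u v) \<subseteq> X"
      using set_foldr_push[of u v] Cons.prems by fastforce
    then have "h (foldr push (a # u) v) = e a \<otimes>\<^bsub>K\<^esub> (h u \<otimes>\<^bsub>K\<^esub> h v)"
      using Cons h_push by simp
    also have "\<dots> = h (a # u) \<otimes>\<^bsub>K\<^esub> h v"
      using Cons.prems e h_closed by (simp add: K.m_assoc h_def[of "a # u"] h_def[of u, symmetric])
    finally show ?case .
  qed
  have hom: "h \<in> hom (free_group X) K"
    by (rule homI) (auto simp: free_group_def h_closed reduce_append h_foldr)
  have ext: "h (free_gen x) = f x" if "x \<in> X" for x
    using funcset_mem[OF f that] by (simp add: h_def free_gen_def e_def)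
  have uniq: "h' w = h w"
    if h': "h' \<in> hom (free_group X) K" and ag: "\<forall>x\<in>X. h' (free_gen x) = f x"
      and "w \<in> carrier (free_group X)" for h' w
  proof -
    interpret h': group_hom "free_group X" K h'
      using h' by unfold_locales
    have gen: "free_gen x \<in> carrier (free_group X)" if "x \<in> X" for x
      using that by (simp add: free_group_def free_gen_def)
    have letter: "h' [a] = e a" if "snd a \<in> X" for a
    proof (cases "fst a")
      case True
      then have "[a] = inv\<^bsub>free_group X\<^esub> (free_gen (snd a))"
        using that by (simp add: inv_free_gen prod_eq_iff)
      then show ?thesis using True that ag gen h'.hom_inv by (simp add: e_def)
    next
      case False
      then have "[a] = free_gen (snd a)"
        by (simp add: free_gen_def prod_eq_iff)
      then show ?thesis using False that ag by (simp add: e_def)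
    qed
    show ?thesis using \<open>w \<in> carrier (free_group X)\<close>
    proof (induction w)
      case Nil
      have "[] = one (free_group X)" by (simp add: free_group_def)
      then show ?case using h'.hom_one by (simp add: h_def)
    next
      case (Cons a w)
      then have w: "w \<in> carrier (free_group X)" "[a] \<in> carrier (free_group X)" "snd a \<in> X"
        by (auto simp: free_group_def dest: reduced_ConsD)
      have "a # w = [a] \<otimes>\<^bsub>free_group X\<^esub> w"
        using Cons.prems reduce_reduced[of "a # w"] by (simp add: free_group_def)
      then have "h' (a # w) = h' [a] \<otimes>\<^bsub>K\<^esub> h' w"
        using w h'.hom_mult by simp
      then show ?case using Cons.IH w letter by (simp add: h_def)
    qed
  qed
  show ?thesis using hom ext uniq by blast
qed


section \<open>Essential subgroups\<close>

definition essential_subgroup :: "'a set \<Rightarrow> ('a, 'b) monoid_scheme \<Rightarrow> bool" where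
  "essential_subgroup H G \<longleftrightarrow>
     subgroup H G \<and> (\<forall>K. subgroup K G \<longrightarrow> K \<noteq> {one G} \<longrightarrow> H \<inter> K \<noteq> {one G})"


section \<open>Cogrowth\<close>

definition minimal_transversal ::
    "('a, 'b) monoid_scheme \<Rightarrow> 'a set \<Rightarrow> 'a set \<Rightarrow> 'a set \<Rightarrow> bool" where
  "minimal_transversal G X H T \<longleftrightarrow>
     T \<subseteq> carrier G \<and>
     (\<forall>C \<in> rcosets\<^bsub>G\<^esub> H. \<exists>!t. t \<in> T \<inter> C) \<and>
     (\<forall>t \<in> T. \<forall>g \<in> H #>\<^bsub>G\<^esub> t. word_length G X t \<le> word_length G X g)"

text \<open>
  The choice of the transversal is immaterial: see \<open>minimal_transversal_exists\<close> and
  \<open>cogrowth_eq_transversal\<close> below.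
\<close>

definition cogrowth ::
    "('a, 'b) monoid_scheme \<Rightarrow> 'a set \<Rightarrow> 'a set \<Rightarrow> nat \<Rightarrow> nat" where
  "cogrowth G X H n =
     card {t \<in> (SOME T. minimal_transversal G X H T). word_length G X t \<le> n}"

lemma minimal_transversal_exists:
  fixes G (structure)
  assumes "group G" "subgroup H G"
  shows "\<exists>T. minimal_transversal G X H T"
proof -
  interpret group G by fact
  interpret H: subgroup H G by fact
  let ?l = "word_length G X"
  have "\<exists>t. t \<in> C \<and> (\<forall>g\<in>C. ?l t \<le> ?l g)" if C: "C \<in> rcosets H" for C
  proof -
    obtain a where "a \<in> carrier G" "C = H #> a" using C by (auto simp: RCOSETS_def)
    then have "a \<in> C" using assms rcos_self by blast
    then show ?thesis using ex_has_least_nat[of "\<lambda>t. t \<in> C" a ?l] by blast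
  qed
  then obtain s where s: "\<And>C. C \<in> rcosets H \<Longrightarrow> s C \<in> C"
      "\<And>C g. C \<in> rcosets H \<Longrightarrow> g \<in> C \<Longrightarrow> ?l (s C) \<le> ?l g"
    by metis
  have carr: "C \<subseteq> carrier G" if "C \<in> rcosets H" for C
    using that H.subset r_coset_subset_G by (auto simp: RCOSETS_def)
  have same: "H #> t = C" if "C \<in> rcosets H" "t \<in> C" for C t
    using that assms repr_independence by (auto simp: RCOSETS_def)
  have "minimal_transversal G X H (s ` (rcosets H))"
    unfolding minimal_transversal_def
  proof (intro conjI ballI)
    show "s ` (rcosets H) \<subseteq> carrier G" using s carr by blast
  next
    fix C assume C: "C \<in> rcosets H"
    show "\<exists>!t. t \<in> s ` (rcosets H) \<inter> C"
    proof (rule ex1I[of _ "s C"])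
      show "s C \<in> s ` (rcosets H) \<inter> C" using C s by blast
    next
      fix t assume "t \<in> s ` (rcosets H) \<inter> C"
      then obtain D where "D \<in> rcosets H" "t = s D" "t \<in> C" by blast
      then show "t = s C" using same[of D t] same[of C t] C s(1) by metis
    qed
  next
    fix t g assume "t \<in> s ` (rcosets H)" "g \<in> H #> t"
    then obtain C where "C \<in> rcosets H" "t = s C" by blast
    then show "?l t \<le> ?l g" using s same[of C t] \<open>g \<in> H #> t\<close> by metis
  qed
  then show ?thesis by blast
qed

lemma card_transversal:
  fixes G (structure)
  assumes "group G" "subgroup H G" and T: "minimal_transversal G X H T"
  shows "card {t \<in> T. word_length G X t \<le> n}
       = card {C \<in> rcosets\<^bsub>G\<^esub> H. \<exists>g\<in>C. word_length G X g \<le> n}"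
proof -
  interpret group G by fact
  interpret H: subgroup H G by fact
  let ?l = "word_length G X"
  have carr: "t \<in> carrier G" if "t \<in> T" for t
    using T that by (auto simp: minimal_transversal_def)
  have self: "t \<in> H #> t" "H #> t \<in> rcosets H" if "t \<in> T" for t
    using carr[OF that] assms rcos_self rcosetsI[OF H.subset] by auto
  have same: "H #> t = C" if "C \<in> rcosets H" "t \<in> C" for C t
    using that assms repr_independence by (auto simp: RCOSETS_def)
  have "bij_betw (\<lambda>t. H #> t) {t \<in> T. ?l t \<le> n} {C \<in> rcosets H. \<exists>g\<in>C. ?l g \<le> n}"
    unfolding bij_betw_def
  proof (intro conjI)
    show "inj_on (\<lambda>t. H #> t) {t \<in> T. ?l t \<le> n}"
    proof (rule inj_onI)
      fix s t assume st: "s \<in> {t \<in> T. ?l t \<le> n}" "t \<in> {t \<in> T. ?l t \<le> n}" "H #> s = H #> t"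
      then have "\<exists>!u. u \<in> T \<inter> (H #> t)"
        using T self by (auto simp: minimal_transversal_def)
      moreover have "s \<in> T \<inter> (H #> t)" "t \<in> T \<inter> (H #> t)" using st self by auto
      ultimately show "s = t" by blast
    qed
    show "(\<lambda>t. H #> t) ` {t \<in> T. ?l t \<le> n} = {C \<in> rcosets H. \<exists>g\<in>C. ?l g \<le> n}"
    proof (intro equalityI subsetI)
      fix C assume "C \<in> (\<lambda>t. H #> t) ` {t \<in> T. ?l t \<le> n}"
      then show "C \<in> {C \<in> rcosets H. \<exists>g\<in>C. ?l g \<le> n}" using self by blast
    next
      fix C assume "C \<in> {C \<in> rcosets H. \<exists>g\<in>C. ?l g \<le> n}"
      then obtain g where C: "C \<in> rcosets H" "g \<in> C" "?l g \<le> n" by blast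
      then have "\<exists>!t. t \<in> T \<inter> C"
        using T by (simp add: minimal_transversal_def)
      then obtain t where t: "t \<in> T" "t \<in> C" by blast
      have Ht: "H #> t = C" using C(1) t(2) by (rule same)
      then have "?l t \<le> ?l g" using T C(2) t(1) by (auto simp: minimal_transversal_def)
      then have "t \<in> {t \<in> T. ?l t \<le> n}" using t(1) C(3) by simp
      then show "C \<in> (\<lambda>t. H #> t) ` {t \<in> T. ?l t \<le> n}" using Ht by blast
    qed
  qed
  then show ?thesis by (rule bij_betw_same_card)
qed

lemma cogrowth_eq_cosets:
  assumes "group G" "subgroup H G"
  shows "cogrowth G X H n = card {C \<in> rcosets\<^bsub>G\<^esub> H. \<exists>g\<in>C. word_length G X g \<le> n}"
  unfolding cogrowth_def
  by (intro card_transversal assms someI_ex[of "minimal_transversal G X H"] minimal_transversal_exists)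

lemma cogrowth_eq_transversal:
  assumes "group G" "subgroup H G" "minimal_transversal G X H T"
  shows "cogrowth G X H n = card {t \<in> T. word_length G X t \<le> n}"
  using card_transversal[OF assms] cogrowth_eq_cosets[OF assms(1,2)] by simp

definition growth_equiv :: "(nat \<Rightarrow> nat) \<Rightarrow> (nat \<Rightarrow> nat) \<Rightarrow> bool" where
  "growth_equiv \<Gamma>\<^sub>1 \<Gamma>\<^sub>2 \<longleftrightarrow>
     (\<exists>C>0. \<forall>n. \<Gamma>\<^sub>1 n \<le> \<Gamma>\<^sub>2 (C * n) \<and> \<Gamma>\<^sub>2 n \<le> \<Gamma>\<^sub>1 (C * n))"


section \<open>The class of functions realised as cogrowth functions\<close>

definition CG :: "(nat \<Rightarrow> nat) set" where
  "CG = {\<alpha>. \<exists>f :: nat \<Rightarrow> nat.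
     f 0 = 1 \<and>
     (\<exists>r :: enat. \<forall>i. (r < enat i \<longrightarrow> f i = 0) \<and> (enat i \<le> r \<longrightarrow> 0 < f i)) \<and>
     (\<exists>d :: real. 0 < d \<and> (\<forall>i. real (f (Suc i)) \<le> d * real (f i))) \<and>
     (\<forall>n. \<alpha> n = (\<Sum>i=0..n. f i))}"

end

theory Submission
  imports Defs "HOL-Library.Countable_Set"
begin

text \<open>
  A subgroup of the free group on two letters is the stabiliser of a point \<open>v0\<close> in a transitive
  action, that is, in a pair of permutations. Its cogrowth counts the points that words of length
  at most \<open>n\<close> reach from \<open>v0\<close> (\<open>cogrowth_stab\<close>). Since free groups are torsion-free, it is
  essential if the orbit of \<open>v0\<close> under each single word is finite (\<open>essential_stab\<close>). So the task is
  to find two permutations with balls of prescribed size around \<open>v0\<close> and such finite orbits.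

  If the given function \<open>n \<mapsto> f 0 + \<dots> + f n\<close> is bounded, a finite cyclic rotation will do
  (\<open>realise_finite\<close>). Otherwise all \<open>f i\<close> are positive, and the points are arranged in a rooted tree
  of circles, with about \<open>f i\<close> points on level \<open>i\<close> (locale \<open>circle_tree\<close>). On level \<open>i\<close> the
  generators act as rotations by \<open>p i\<close> and \<open>q i\<close>, except that the second generator also passes
  between a circle and its parent or children, through few attachment points.

  A word \<open>w\<close> is trapped by one level. There are coprime \<open>p\<close> and \<open>q\<close> for which the total rotation
  along \<open>w\<close> is \<open>0\<close>. If the circles of some level rotate by these amounts and are long, with
  the attachment points of their children opposite to that of the parent, then \<open>w\<close> fixes all points
  of a wide zone in between. An orbit of \<open>w\<close> that starts before the zone cannot get past it,
  because \<open>w\<close> moves points by a bounded amount and points of the zone not at all. So it stays in a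
  finite set (\<open>trap\<close>). There are countably many words, and each is given its own trap level.

  It remains to control the number of points. The equivalence of growth functions allows the
  argument to be rescaled, but not the value to be multiplied by a constant. Trap levels are
  therefore very sparse, and are taken among the infinitely many \<open>i\<close> at which \<open>f i\<close> is the minimum
  of all later values. The additional points on trap levels up to \<open>n\<close> are then no more than the sum
  of \<open>f\<close> over the levels from \<open>n\<close> to \<open>2 * n\<close> (\<open>sparse_placement\<close>, \<open>realise_infinite\<close>).
\<close>

section \<open>Torsion-freeness of free groups\<close>

lemma reduced_append_iff:
  "reduced (u @ v) \<longleftrightarrow>
     reduced u \<and> reduced v \<and> (u \<noteq> [] \<longrightarrow> v \<noteq> [] \<longrightarrow> hd v \<noteq> inv_letter (last u))"
proof (induction u rule: reduced.induct)
  case ("2_2" a)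
  then show ?case by (cases v) auto
qed auto

lemma (in group) conj_nat_pow:
  assumes "x \<in> carrier G" "u \<in> carrier G"
  shows "(x \<otimes> u \<otimes> inv x) [^] (n::nat) = x \<otimes> u [^] n \<otimes> inv x"
proof (induction n)
  case (Suc n)
  have "x \<otimes> u [^] n \<otimes> inv x \<otimes> (x \<otimes> u \<otimes> inv x) = x \<otimes> u [^] n \<otimes> (inv x \<otimes> x) \<otimes> u \<otimes> inv x"
    using assms by (simp only: m_assoc m_closed inv_closed nat_pow_closed)
  then show ?case
    using assms Suc by (simp add: m_assoc)
qed (use assms in simp)

text \<open>
  Conjugating away a first letter that is cancelled by the last one shortens the word and does not
  change the order of the element, so the word may be taken cyclically reduced; then its powers are reduced as they
  stand, being plain concatenations.
\<close>
lemma free_group_pow_ne_one: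
  assumes "w \<in> carrier (free_group X)" "w \<noteq> []" "0 < n"
  shows "w [^]\<^bsub>free_group X\<^esub> (n::nat) \<noteq> []"
  using assms(1,2)
proof (induction w rule: length_induct)
  case (1 w)
  interpret F: group "free_group X" by (rule group_free_group)
  have red: "reduced w" using 1 by (simp add: free_group_def)
  show ?case
  proof (cases "hd w = inv_letter (last w)")
    case False
    have "reduced (concat (replicate m w)) \<and>
        (0 < m \<longrightarrow> concat (replicate m w) \<noteq> [] \<and> last (concat (replicate m w)) = last w) \<and>
        w [^]\<^bsub>free_group X\<^esub> m = concat (replicate m w)" for m
    proof (induction m)
      case 0
      then show ?case by (simp add: free_group_def)
    next
      case (Suc m)
      have sw: "concat (replicate (Suc m) w) = concat (replicate m w) @ w"
        using arg_cong[OF replicate_append_same[of m w], of concat] by simp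
      have "reduced (concat (replicate m w) @ w)"
        using Suc False red reduced_append_iff[of "concat (replicate m w)" w]
        by (cases "m = 0") auto
      then show ?case
        using Suc 1(3) unfolding sw by (simp add: free_group_def reduce_reduced)
    qed
    then show ?thesis using assms(3) by metis
  next
    case True
    obtain a v where av: "w = a # v" using 1(3) by (cases w) auto
    with True have "v \<noteq> []" by auto
    then obtain u b where ub: "v = u @ [b]" by (cases v rule: rev_cases) auto
    with True av have w: "w = a # u @ [inv_letter a]" by auto
    have "u \<noteq> []" using red w by auto
    have "reduced ([a] @ (u @ [inv_letter a]))" using red w by simp
    then have "reduced u" unfolding reduced_append_iff by auto
    then have u: "u \<in> carrier (free_group X)" and a: "[a] \<in> carrier (free_group X)"
      using 1(2) w by (auto simp: free_group_def)
    have "inv_letter (inv_letter a) = a" by simp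
    then have inv_a: "inv\<^bsub>free_group X\<^esub> [a] = [inv_letter a]"
      using a by (intro F.inv_equality) (auto simp: free_group_def reduce_def)
    have "reduce ([a] @ u) = [a] @ u"
      using red w by (intro reduce_reduced) (simp add: reduced_append_iff[of "a # u", simplified])
    then have conj: "w = [a] \<otimes>\<^bsub>free_group X\<^esub> u \<otimes>\<^bsub>free_group X\<^esub> inv\<^bsub>free_group X\<^esub> [a]"
      using red w unfolding inv_a by (simp add: free_group_def reduce_reduced)
    have pow: "w [^]\<^bsub>free_group X\<^esub> n
        = [a] \<otimes>\<^bsub>free_group X\<^esub> u [^]\<^bsub>free_group X\<^esub> n \<otimes>\<^bsub>free_group X\<^esub> inv\<^bsub>free_group X\<^esub> [a]"
      unfolding conj by (rule F.conj_nat_pow[OF a u])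
    have ne: "u [^]\<^bsub>free_group X\<^esub> n \<noteq> \<one>\<^bsub>free_group X\<^esub>"
      using 1(1) w u \<open>u \<noteq> []\<close> by (auto simp: free_group_def)
    have "w [^]\<^bsub>free_group X\<^esub> n \<noteq> \<one>\<^bsub>free_group X\<^esub>"
    proof
      assume "w [^]\<^bsub>free_group X\<^esub> n = \<one>\<^bsub>free_group X\<^esub>"
      then have "[a] \<otimes>\<^bsub>free_group X\<^esub> u [^]\<^bsub>free_group X\<^esub> n = [a] \<otimes>\<^bsub>free_group X\<^esub> \<one>\<^bsub>free_group X\<^esub>"
        using pow a u F.inv_closed[OF a] F.nat_pow_closed[OF u]
        by (metis F.inv_equality F.inv_inv F.m_closed F.r_one)
      then show False using ne a u by simp
    qed
    then show ?thesis by (simp add: free_group_def)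
  qed
qed

section \<open>Stabilisers of actions of a free group\<close>

text \<open>
  A right action of the free group: the word \<open>w\<close> sends \<open>v\<close> to \<open>fold step w v\<close>, its first letter
  acting first, so that right cosets of the stabiliser of \<open>v0\<close> correspond to points of the orbit
  of \<open>v0\<close>.
\<close>
locale letter_action =
  fixes X :: "'a set" and V :: "'v set" and step :: "'a letter \<Rightarrow> 'v \<Rightarrow> 'v" and v0 :: 'v
  assumes step_closed: "snd a \<in> X \<Longrightarrow> v \<in> V \<Longrightarrow> step a v \<in> V"
    and step_inv: "snd a \<in> X \<Longrightarrow> v \<in> V \<Longrightarrow> step (inv_letter a) (step a v) = v"
    and base: "v0 \<in> V"
begin

abbreviation "F \<equiv> free_group X"

definition stab :: "'a letter list set" where
  "stab = {w \<in> carrier F. fold step w v0 = v0}"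

definition ball :: "nat \<Rightarrow> 'v set" where
  "ball n = {fold step w v0 | w. snd ` set w \<subseteq> X \<and> length w \<le> n}"

lemma fold_closed: "snd ` set w \<subseteq> X \<Longrightarrow> v \<in> V \<Longrightarrow> fold step w v \<in> V"
  by (induction w arbitrary: v) (auto simp: step_closed)

lemma fold_push:
  assumes "snd ` set (a # w) \<subseteq> X" "v \<in> V"
  shows "fold step (push a w) v = fold step (a # w) v"
  using assms by (cases w) (auto simp: step_inv)

lemma fold_foldr_push:
  assumes "snd ` set u \<subseteq> X" "snd ` set w \<subseteq> X" "v \<in> V"
  shows "fold step (foldr push u w) v = fold step (u @ w) v"
  using assms
proof (induction u arbitrary: v)
  case (Cons a u)
  have "snd ` set (a # foldr push u w) \<subseteq> X"
    using set_foldr_push[of u w] Cons.prems by fastforce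
  then show ?case
    using Cons fold_push[of a "foldr push u w" v] by (simp add: step_closed)
qed simp

lemma fold_reduce: "snd ` set w \<subseteq> X \<Longrightarrow> v \<in> V \<Longrightarrow> fold step (reduce w) v = fold step w v"
  using fold_foldr_push[of w "[]" v] by (simp add: reduce_def)

lemma fold_mult:
  "u \<in> carrier F \<Longrightarrow> w \<in> carrier F \<Longrightarrow> v \<in> V \<Longrightarrow>
     fold step (u \<otimes>\<^bsub>F\<^esub> w) v = fold step w (fold step u v)"
  by (simp add: free_group_def fold_reduce image_Un)

lemma fold_one: "fold step \<one>\<^bsub>F\<^esub> v = v"
  by (simp add: free_group_def)

lemma fold_cancel:
  assumes "u \<in> carrier F" "v \<in> V" "v' \<in> V" "fold step u v = fold step u v'"
  shows "v = v'"
proof -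
  interpret F: group F by (rule group_free_group)
  have "fold step (inv\<^bsub>F\<^esub> u) (fold step u z) = z" if "z \<in> V" for z
    using fold_mult[of u "inv\<^bsub>F\<^esub> u" z] assms(1) that by (simp add: fold_one)
  then show ?thesis using assms by metis
qed

lemma subgroup_stab: "subgroup stab F"
proof -
  interpret F: group F by (rule group_free_group)
  have "fold step (inv\<^bsub>F\<^esub> u) v0 = v0" if "u \<in> stab" for u
  proof -
    have "fold step (u \<otimes>\<^bsub>F\<^esub> inv\<^bsub>F\<^esub> u) v0 = fold step (inv\<^bsub>F\<^esub> u) v0"
      using that base by (subst fold_mult) (auto simp: stab_def)
    then show ?thesis using that by (auto simp: stab_def fold_one)
  qed
  moreover have "[] \<in> stab" by (auto simp: stab_def free_group_def)
  ultimately show ?thesis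
    by (intro F.subgroupI) (auto simp: stab_def fold_mult base)
qed

lemma coset_eq:
  assumes g: "g \<in> carrier F"
  shows "stab #>\<^bsub>F\<^esub> g = {w \<in> carrier F. fold step w v0 = fold step g v0}"
proof -
  interpret F: group F by (rule group_free_group)
  show ?thesis
  proof (intro equalityI subsetI)
    fix w assume "w \<in> stab #>\<^bsub>F\<^esub> g"
    then show "w \<in> {w \<in> carrier F. fold step w v0 = fold step g v0}"
      using g base by (auto simp: r_coset_def stab_def fold_mult)
  next
    fix w assume w: "w \<in> {w \<in> carrier F. fold step w v0 = fold step g v0}"
    define s where "s = w \<otimes>\<^bsub>F\<^esub> inv\<^bsub>F\<^esub> g"
    have s: "s \<in> carrier F" "w = s \<otimes>\<^bsub>F\<^esub> g" using w g by (auto simp: s_def F.m_assoc)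
    then have "fold step g (fold step s v0) = fold step g v0"
      using w g base fold_mult by auto
    moreover have "fold step s v0 \<in> V"
      using s base by (intro fold_closed) (auto simp: free_group_def)
    ultimately have "fold step s v0 = v0" using fold_cancel g base by blast
    then show "w \<in> stab #>\<^bsub>F\<^esub> g"
      using s by (auto simp: r_coset_def stab_def)
  qed
qed

text \<open>
  A coset is determined by the common image of \<open>v0\<close> under its elements. Words that are not
  reduced may be allowed in \<open>ball\<close>, because reducing a word shortens it and does not change its
  action.
\<close>
theorem cogrowth_stab: "cogrowth F (free_gen ` X) stab n = card (ball n)"
proof -
  interpret F: group F by (rule group_free_group)
  let ?\<C> = "{C \<in> rcosets\<^bsub>F\<^esub> stab. \<exists>g\<in>C. word_length F (free_gen ` X) g \<le> n}"
  let ?E = "\<lambda>v. {w \<in> carrier F. fold step w v0 = v}"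
  have "bij_betw ?E (ball n) ?\<C>"
    unfolding bij_betw_def
  proof (intro conjI)
    have rep: "\<exists>g \<in> carrier F. length g \<le> n \<and> fold step g v0 = v" if v: "v \<in> ball n" for v
    proof -
      obtain w where w: "v = fold step w v0" "snd ` set w \<subseteq> X" "length w \<le> n"
        using v unfolding ball_def by auto
      have "set (reduce w) \<subseteq> set w" using set_foldr_push[of w "[]"] by (simp add: reduce_def)
      then have "reduce w \<in> carrier F"
        using w by (auto simp: free_group_def reduced_reduce)
      then show ?thesis
        using w fold_reduce[of w v0] base length_reduce[of w] by (intro bexI[of _ "reduce w"]) auto
    qed
    show "inj_on ?E (ball n)"
      using rep by (intro inj_onI) blast
    show "?E ` ball n = ?\<C>"
    proof (intro equalityI subsetI)
      fix C assume "C \<in> ?E ` ball n"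
      then obtain v where v: "v \<in> ball n" "C = ?E v" by blast
      then obtain g where g: "g \<in> carrier F" "length g \<le> n" "fold step g v0 = v"
        using rep by blast
      then have "C = stab #>\<^bsub>F\<^esub> g" using coset_eq v by simp
      moreover have "stab \<subseteq> carrier F" by (auto simp: stab_def)
      ultimately have "C \<in> rcosets\<^bsub>F\<^esub> stab" using g F.rcosetsI by simp
      moreover have "g \<in> C" using g v by simp
      ultimately show "C \<in> ?\<C>"
        using g word_length_free_group[of g X] by (intro CollectI conjI bexI[of _ g]) auto
    next
      fix C assume "C \<in> ?\<C>"
      then obtain x g where x: "x \<in> carrier F" "C = stab #>\<^bsub>F\<^esub> x" "g \<in> C"
          "word_length F (free_gen ` X) g \<le> n"
        by (auto simp: RCOSETS_def)
      have C: "C = ?E (fold step x v0)" using x coset_eq by simp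
      then have g: "g \<in> carrier F" "fold step g v0 = fold step x v0" using x by auto
      have "length g \<le> n" using x(4) unfolding word_length_free_group[OF g(1)] .
      moreover have "snd ` set g \<subseteq> X" using g(1) by (simp add: free_group_def)
      ultimately have "fold step x v0 \<in> ball n"
        using g(2) unfolding ball_def by (intro CollectI exI[of _ g]) simp
      then show "C \<in> ?E ` ball n" using C by blast
    qed
  qed
  then show ?thesis
    unfolding cogrowth_eq_cosets[OF group_free_group subgroup_stab]
    by (simp add: bij_betw_same_card)
qed

lemma cogrowth_stab_0: "cogrowth F (free_gen ` X) stab 0 = 1"
proof -
  have "ball 0 = {v0}" by (auto simp: ball_def)
  then show ?thesis by (simp add: cogrowth_stab)
qed

text \<open>
  If \<open>w\<close> maps a finite set containing \<open>v0\<close> into itself, then by the pigeonhole principle some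
  positive power of \<open>w\<close> fixes \<open>v0\<close>. For \<open>w \<noteq> 1\<close> in a subgroup \<open>K\<close> this power is a non-trivial
  element of the intersection with \<open>K\<close>, since the free group has no torsion.
\<close>
theorem essential_stab:
  assumes "\<And>w. w \<in> carrier F \<Longrightarrow> \<exists>A. finite A \<and> v0 \<in> A \<and> fold step w ` A \<subseteq> A"
  shows "essential_subgroup stab F"
  unfolding essential_subgroup_def
proof (intro conjI allI impI)
  show "subgroup stab F" by (rule subgroup_stab)
next
  interpret F: group F by (rule group_free_group)
  fix K assume K: "subgroup K F" "K \<noteq> {\<one>\<^bsub>F\<^esub>}"
  then obtain w where w: "w \<in> K" "w \<noteq> []"
    using subgroup.one_closed[OF K(1)] by (auto simp: free_group_def)
  then have wF: "w \<in> carrier F" using K subgroup.subset by blast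
  obtain A where A: "finite A" "v0 \<in> A" "fold step w ` A \<subseteq> A" using assms wF by blast
  have "fold step (w [^]\<^bsub>F\<^esub> n) v0 \<in> A" for n :: nat
  proof (induction n)
    case 0
    then show ?case using A by (simp add: free_group_def)
  next
    case (Suc n)
    then show ?case using A wF base by (auto simp: fold_mult)
  qed
  then have "\<not> inj (\<lambda>n::nat. fold step (w [^]\<^bsub>F\<^esub> n) v0)"
    using A(1) by (metis finite_imageD finite_subset image_subsetI infinite_UNIV_nat)
  then obtain m n :: nat where mn: "m < n"
      "fold step (w [^]\<^bsub>F\<^esub> m) v0 = fold step (w [^]\<^bsub>F\<^esub> n) v0"
    unfolding inj_def by (metis linorder_neqE_nat)
  let ?u = "w [^]\<^bsub>F\<^esub> (n - m)"
  have "w [^]\<^bsub>F\<^esub> n = ?u \<otimes>\<^bsub>F\<^esub> w [^]\<^bsub>F\<^esub> m"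
    using mn wF by (simp add: F.nat_pow_mult)
  then have "fold step (w [^]\<^bsub>F\<^esub> m) (fold step ?u v0) = fold step (w [^]\<^bsub>F\<^esub> m) v0"
    using mn wF base by (simp add: fold_mult)
  moreover have uF: "?u \<in> carrier F" using wF by simp
  moreover have "fold step ?u v0 \<in> V"
    using uF base by (intro fold_closed) (auto simp: free_group_def)
  ultimately have "fold step ?u v0 = v0" using fold_cancel wF base by (metis F.nat_pow_closed)
  moreover have "w [^]\<^bsub>F\<^esub> k \<in> K" for k :: nat
    using w K(1) by (induction k) (auto intro: subgroup.m_closed subgroup.one_closed)
  ultimately have "?u \<in> stab \<inter> K"
    using uF by (simp add: stab_def)
  moreover have "?u \<noteq> \<one>\<^bsub>F\<^esub>"
    using free_group_pow_ne_one[OF wF w(2)] mn by (auto simp: free_group_def)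
  ultimately show "stab \<inter> K \<noteq> {\<one>\<^bsub>F\<^esub>}" by blast
qed

end

section \<open>Trees of circles and their balls\<close>

text \<open>
  The distance from \<open>t\<close> to \<open>0\<close> on the circle of residues modulo \<open>N\<close>, for \<open>0 \<le> t < N\<close>.
\<close>
definition circ_dist :: "int \<Rightarrow> int \<Rightarrow> int" where
  "circ_dist N t = min t (N - t)"

lemma circ_dist_mod:
  assumes "0 \<le> t" "t < N"
  shows "circ_dist N ((t + x) mod N) \<le> circ_dist N t + \<bar>x\<bar>"
    and "circ_dist N t \<le> circ_dist N ((t + x) mod N) + \<bar>x\<bar>"
proof -
  let ?s = "(t + x) mod N"
  have s: "0 \<le> ?s" "?s < N" using assms by auto
  have "\<bar>x\<bar> < N \<Longrightarrow> ?s = t + x \<or> ?s = t + x - N \<or> ?s = t + x + N"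
  proof -
    assume x: "\<bar>x\<bar> < N"
    consider "t + x < 0" | "0 \<le> t + x" "t + x < N" | "N \<le> t + x" by linarith
    then show ?thesis
    proof cases
      case 1
      then have "(t + x + N) mod N = t + x + N" using x assms by (intro mod_pos_pos_trivial) auto
      then show ?thesis by simp
    next
      case 3
      then have "(t + x - N) mod N = t + x - N" using x assms by (intro mod_pos_pos_trivial) auto
      then show ?thesis by simp
    qed auto
  qed
  then show "circ_dist N ?s \<le> circ_dist N t + \<bar>x\<bar>" "circ_dist N t \<le> circ_dist N ?s + \<bar>x\<bar>"
    using s assms unfolding circ_dist_def by (smt (verit))+
qed

text \<open>
  Every point of a circle is reached from \<open>0\<close> by forward rotations by \<open>p\<close> and \<open>q\<close> alone, fewer than
  \<open>N\<close> of each: a Bezout relation, multiplied by \<open>t\<close>, with coefficients reduced modulo \<open>N\<close>. The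
  bound does not involve \<open>p\<close> and \<open>q\<close>.
\<close>
lemma coprime_residue_combination:
  fixes p q N t :: int
  assumes "coprime p q" "0 < N" "0 \<le> t" "t < N"
  obtains x y :: nat where "int x < N" "int y < N" "(int x * p + int y * q) mod N = t"
proof -
  obtain u v where uv: "u * p + v * q = 1"
    using bezout_int[of p q] assms(1) by auto
  define x where "x = nat ((t * u) mod N)"
  define y where "y = nat ((t * v) mod N)"
  have xy: "int x = (t * u) mod N" "int y = (t * v) mod N"
    using assms by (auto simp: x_def y_def)
  have "(int x * p + int y * q) mod N = (t * u * p + t * v * q) mod N"
    unfolding xy by (intro mod_add_cong mod_mult_cong) simp_all
  also have "t * u * p + t * v * q = t * (u * p + v * q)" by (simp add: algebra_simps)
  finally have "(int x * p + int y * q) mod N = t" using uv assms by simp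
  then show thesis using that[of x y] xy assms by simp
qed

text \<open>
  Under the homomorphism to the integers with \<open>x \<mapsto> p\<close> and with every other generator sent to \<open>q\<close>,
  this is the image of a letter.
\<close>
definition weight :: "'a \<Rightarrow> int \<Rightarrow> int \<Rightarrow> 'a letter \<Rightarrow> int" where
  "weight x p q a = (if fst a then - 1 else 1) * (if snd a = x then p else q)"

text \<open>
  Level \<open>i\<close> consists of \<open>h i\<close> circles \<open>(i, k)\<close>, each with the points \<open>(i, k, t)\<close>, \<open>0 \<le> t < N i\<close>.
  The circle \<open>(i, k)\<close> is attached to its parent \<open>(i - 1, k div D)\<close> at its point \<open>0\<close>, and its
  children use the \<open>D\<close> points \<open>S i, \<dots>, S i + D - 1\<close>, which lie opposite to \<open>0\<close>: with
  \<open>N i = 2 * S i + D\<close> they have distance at least \<open>S i\<close> from \<open>0\<close> in both directions. The involution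
  \<open>link\<close> exchanges the two points of every attachment. The first generator rotates the circles of
  level \<open>i\<close> by \<open>p i\<close>; the second applies \<open>link\<close> and then rotates by \<open>q i\<close>.

  Since \<open>link\<close> takes an edge away from the rotation by \<open>q i\<close>, connectedness could fail. The
  condition that of two consecutive levels one has \<open>q = 0\<close> prevents this; see \<open>rot_q_ball\<close>.
\<close>
locale circle_tree =
  fixes x1 x2 :: 'a and h :: "nat \<Rightarrow> nat" and D :: nat and p q S :: "nat \<Rightarrow> int"
  assumes distinct: "x1 \<noteq> x2"
    and h_0: "h 0 = 1" and h_Suc: "h (Suc i) \<le> D * h i"
    and D_pos: "0 < D" and D_le_S: "int D \<le> S i"
    and coprime_pq: "coprime (p i) (q i)"
    and q_zero: "q i = 0 \<or> q (Suc i) = 0"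
begin

definition N :: "nat \<Rightarrow> int" where "N i = 2 * S i + int D"

definition V :: "(nat \<times> nat \<times> int) set" where
  "V = {(i, k, t). k < h i \<and> 0 \<le> t \<and> t < N i}"

fun rot :: "(nat \<Rightarrow> int) \<Rightarrow> nat \<times> nat \<times> int \<Rightarrow> nat \<times> nat \<times> int" where
  "rot c (i, k, t) = (i, k, (t + c i) mod N i)"

fun link :: "nat \<times> nat \<times> int \<Rightarrow> nat \<times> nat \<times> int" where
  "link (i, k, t) =
     (if t = 0 then (case i of 0 \<Rightarrow> (i, k, t) | Suc j \<Rightarrow> (j, k div D, S j + int (k mod D)))
      else if S i \<le> t \<and> t < S i + int D \<and> D * k + nat (t - S i) < h (Suc i)
        then (Suc i, D * k + nat (t - S i), 0)
      else (i, k, t))"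

definition step :: "'a letter \<Rightarrow> nat \<times> nat \<times> int \<Rightarrow> nat \<times> nat \<times> int" where
  "step a v =
     (if snd a = x1 then rot (if fst a then - p else p) v
      else if fst a then link (rot (- q) v) else rot q (link v))"

lemma S_pos: "0 < S i"
  using D_le_S[of i] D_pos by linarith

lemma N_pos: "0 < N i"
  using S_pos[of i] by (simp add: N_def)

lemma fst_rot [simp]: "fst (rot c v) = fst v"
  by (cases v) simp

lemma rot_closed: "v \<in> V \<Longrightarrow> rot c v \<in> V"
  using N_pos by (auto simp: V_def)

lemma rot_zero: "v \<in> V \<Longrightarrow> c (fst v) = 0 \<Longrightarrow> rot c v = v"
  by (cases v) (auto simp: V_def)

lemma rot_inv: "v \<in> V \<Longrightarrow> rot (- c) (rot c v) = v" "v \<in> V \<Longrightarrow> rot c (rot (- c) v) = v"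
  by (cases v; auto simp: V_def mod_simps)+

lemma link_closed:
  assumes "v \<in> V" shows "link v \<in> V"
proof -
  obtain i k t where v: "v = (i, k, t)" by (cases v)
  show ?thesis
  proof (cases "\<exists>j. i = Suc j \<and> t = 0")
    case True
    then obtain j where j: "i = Suc j" "t = 0" by blast
    then have "k < D * h j" using assms v h_Suc[of j] by (auto simp: V_def)
    then have "k div D < h j" by (simp add: less_mult_imp_div_less mult.commute)
    moreover have "int (k mod D) < int D" using D_pos by simp
    ultimately show ?thesis using v j S_pos[of j] by (auto simp: V_def N_def)
  next
    case False
    then show ?thesis using assms v N_pos by (auto simp: V_def split: nat.split)
  qed
qed

lemma link_link:
  assumes "v \<in> V" shows "link (link v) = v"
proof -
  obtain i k t where v: "v = (i, k, t)" by (cases v)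
  show ?thesis
  proof (cases "\<exists>j. i = Suc j \<and> t = 0")
    case True
    then obtain j where j: "i = Suc j" "t = 0" by blast
    have "int (k mod D) < int D" using D_pos by simp
    moreover have "D * (k div D) + k mod D = k" by simp
    moreover have "k < h (Suc j)" using assms v j by (auto simp: V_def)
    ultimately show ?thesis using v j S_pos[of j] by (auto simp del: mult_div_mod_eq)
  next
    case False
    show ?thesis
    proof (cases "t \<noteq> 0 \<and> S i \<le> t \<and> t < S i + int D \<and> D * k + nat (t - S i) < h (Suc i)")
      case True
      then have "nat (t - S i) < D" by auto
      then have "(D * k + nat (t - S i)) div D = k" "(D * k + nat (t - S i)) mod D = nat (t - S i)"
        using D_pos by auto
      then show ?thesis using True v by auto
    next
      case 2: False
      then have "link v = v" using False v by (auto split: nat.split)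
      then show ?thesis by simp
    qed
  qed
qed

lemma link_level:
  assumes "link v \<noteq> v"
  shows "fst (link v) = Suc (fst v) \<or> fst v = Suc (fst (link v))"
  using assms by (cases v) (auto split: nat.splits if_splits)

sublocale letter_action "{x1, x2}" V step "(0, 0, 0)"
proof
  fix a :: "'a letter" and v assume "v \<in> V"
  then show "step a v \<in> V" by (simp add: step_def rot_closed link_closed)
next
  fix a :: "'a letter" and v assume "v \<in> V"
  then show "step (inv_letter a) (step a v) = v"
    by (auto simp: step_def inv_letter_def rot_inv link_link link_closed rot_closed)
next
  show "(0, 0, 0) \<in> V" using h_0 N_pos[of 0] by (simp add: V_def)
qed

lemma V_upto: "{v \<in> V. fst v \<le> n} = (SIGMA i:{..n}. {..<h i} \<times> {0..<N i})"
  by (auto simp: V_def)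

lemma finite_V_upto: "finite {v \<in> V. fst v \<le> n}"
  unfolding V_upto by auto

lemma card_V_upto: "card {v \<in> V. fst v \<le> n} = (\<Sum>i\<le>n. h i * nat (N i))"
  unfolding V_upto by (simp add: card_SigmaI card_cartesian_product)

lemma fst_fold_step: "fst (fold step w v) \<le> fst v + length w"
proof (induction w arbitrary: v)
  case (Cons a w)
  have link: "fst (link u) \<le> Suc (fst u)" for u
    using link_level[of u] by (cases "link u = u") auto
  have "fst (step a v) \<le> Suc (fst v)"
    using link[of v] link[of "rot (- q) v"] by (simp add: step_def)
  then show ?case using Cons[of "step a v"] by simp
qed simp

lemma ball_subset: "ball n \<subseteq> {v \<in> V. fst v \<le> n}"
proof
  fix v assume "v \<in> ball n"
  then obtain w where w: "v = fold step w (0, 0, 0)" "snd ` set w \<subseteq> {x1, x2}" "length w \<le> n"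
    by (auto simp: ball_def)
  then show "v \<in> {v \<in> V. fst v \<le> n}"
    using fst_fold_step[of w "(0, 0, 0)"] fold_closed[of w] base by auto
qed

lemma ball_mono: "m \<le> n \<Longrightarrow> ball m \<subseteq> ball n"
  unfolding ball_def by (intro Collect_mono) (metis le_trans)

lemma step_ball:
  assumes "v \<in> ball n" "snd a \<in> {x1, x2}"
  shows "step a v \<in> ball (Suc n)"
proof -
  obtain w where w: "v = fold step w (0, 0, 0)" "snd ` set w \<subseteq> {x1, x2}" "length w \<le> n"
    using assms by (auto simp: ball_def)
  then show ?thesis
    unfolding ball_def using assms(2) by (intro CollectI exI[of _ "w @ [a]"]) auto
qed

lemma rot_p_ball: "v \<in> ball n \<Longrightarrow> rot p v \<in> ball (Suc n)"
  using step_ball[of v n "(False, x1)"] by (simp add: step_def)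

text \<open>
  A point that \<open>link\<close> fixes is rotated by the second generator itself. Otherwise that generator
  first moves \<open>v\<close> to the adjacent circle; if \<open>q\<close> is not \<open>0\<close> on the level of \<open>v\<close>, it is \<open>0\<close> there, so a
  second application brings the point back and performs the rotation. So two letters always suffice.
\<close>
lemma rot_q_ball:
  assumes "v \<in> ball n" shows "rot q v \<in> ball (n + 2)"
proof -
  have v: "v \<in> V" using assms ball_subset by blast
  have b: "rot q (link u) \<in> ball (Suc m)" if "u \<in> ball m" for u m
    using step_ball[OF that, of "(False, x2)"] distinct by (simp add: step_def)
  consider "q (fst v) = 0" | "link v = v" | "q (fst v) \<noteq> 0" "link v \<noteq> v" by blast
  then show ?thesis
  proof cases
    case 1
    then show ?thesis using rot_zero[OF v] assms ball_mono[of n "n + 2"] by auto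
  next
    case 2
    then show ?thesis using b[OF assms] ball_mono[of "Suc n" "n + 2"] by auto
  next
    case 3
    then have "q (fst (link v)) = 0"
      using link_level[of v] q_zero[of "fst v"] q_zero[of "fst (link v)"] by auto
    then have "link v \<in> ball (Suc n)"
      using b[OF assms] rot_zero[OF link_closed[OF v]] by simp
    then show ?thesis using b[of "link v" "Suc n"] link_link[OF v] by simp
  qed
qed

lemma rotations_ball:
  assumes "(i, k, 0) \<in> ball n"
  shows "(i, k, (int x * p i + int y * q i) mod N i) \<in> ball (n + x + 2 * y)"
proof (induction y)
  case 0
  show ?case
  proof (induction x)
    case 0
    then show ?case using assms by simp
  next
    case (Suc x)
    then show ?case using rot_p_ball[OF Suc] by (simp add: mod_simps algebra_simps)
  qed
next
  case (Suc y)
  then show ?case using rot_q_ball[OF Suc] by (simp add: mod_simps algebra_simps)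
qed

lemma circle_ball:
  assumes "(i, k, 0) \<in> ball n" "0 \<le> t" "t < N i"
  shows "(i, k, t) \<in> ball (n + nat (3 * N i) - 1)"
proof -
  obtain x y where xy: "int x < N i" "int y < N i" "(int x * p i + int y * q i) mod N i = t"
    using coprime_residue_combination[OF coprime_pq N_pos assms(2,3)] by blast
  then have "n + x + 2 * y \<le> n + nat (3 * N i) - 1" by linarith
  then show ?thesis using rotations_ball[OF assms(1), of x y] xy ball_mono by blast
qed

text \<open>
  The point \<open>0\<close> of a circle is one letter away from its parent circle, because \<open>q\<close> vanishes on one
  of the two levels: the second generator or its inverse then acts as \<open>link\<close> alone.
\<close>
lemma level_ball: "v \<in> V \<Longrightarrow> fst v = i \<Longrightarrow> v \<in> ball (\<Sum>l\<le>i. nat (3 * N l))"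
proof (induction i arbitrary: v)
  case 0
  then obtain t where v: "v = (0, 0, t)" "0 \<le> t" "t < N 0"
    using h_0 by (cases v) (auto simp: V_def)
  have "(0, 0, 0) \<in> ball 0" by (simp add: ball_def)
  then have "v \<in> ball (nat (3 * N 0) - 1)" using circle_ball[of 0 0 0 t] v by simp
  then show ?case using ball_mono[of "nat (3 * N 0) - 1" "nat (3 * N 0)"] by auto
next
  case (Suc i)
  let ?m = "\<Sum>l\<le>i. nat (3 * N l)"
  obtain k t where v: "v = (Suc i, k, t)" "0 \<le> t" "t < N (Suc i)" "k < h (Suc i)"
    using Suc.prems by (cases v) (auto simp: V_def)
  let ?v = "(Suc i, k, 0)"
  define u where "u = link ?v"
  have vV: "?v \<in> V" using v N_pos by (simp add: V_def)
  then have u: "u \<in> V" "fst u = i" "link u = ?v"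
    using link_closed link_link by (auto simp: u_def simp del: link.simps) simp
  then have ub: "u \<in> ball ?m" using Suc.IH by blast
  have "?v \<in> ball (Suc ?m)"
  proof (cases "q i = 0")
    case True
    have "step (True, x2) u = ?v"
      using distinct True u rot_zero[OF u(1), of "- q"] by (simp add: step_def)
    then show ?thesis using step_ball[OF ub, of "(True, x2)"] by simp
  next
    case False
    then have "q (Suc i) = 0" using q_zero by blast
    then have "step (False, x2) u = ?v"
      using distinct u rot_zero[OF vV, of q] by (simp add: step_def)
    then show ?thesis using step_ball[OF ub, of "(False, x2)"] by simp
  qed
  then show ?case
    using circle_ball[of "Suc i" k "Suc ?m" t] v N_pos[of "Suc i"] by simp
qed

lemma ball_superset:
  assumes "(\<Sum>l\<le>n. nat (3 * N l)) \<le> m"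
  shows "{v \<in> V. fst v \<le> n} \<subseteq> ball m"
proof
  fix v assume v: "v \<in> {v \<in> V. fst v \<le> n}"
  then have "(\<Sum>l\<le>fst v. nat (3 * N l)) \<le> (\<Sum>l\<le>n. nat (3 * N l))"
    by (intro sum_mono2) auto
  then show "v \<in> ball m" using assms level_ball[of v "fst v"] v ball_mono by blast
qed

lemma finite_ball: "finite (ball n)"
  using ball_subset finite_V_upto finite_subset by blast

lemma cogrowth_le: "cogrowth F (free_gen ` {x1, x2}) stab n \<le> (\<Sum>i\<le>n. h i * nat (N i))"
  unfolding cogrowth_stab card_V_upto[symmetric] using ball_subset finite_V_upto by (intro card_mono)

lemma cogrowth_ge:
  assumes "(\<Sum>l\<le>n. nat (3 * N l)) \<le> m"
  shows "(\<Sum>i\<le>n. h i * nat (N i)) \<le> cogrowth F (free_gen ` {x1, x2}) stab m"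
  unfolding cogrowth_stab card_V_upto[symmetric]
  using ball_superset[OF assms] finite_ball by (intro card_mono)

section \<open>Levels that trap the orbits of a word\<close>

abbreviation shift :: "nat \<Rightarrow> 'a letter \<Rightarrow> int" where
  "shift i \<equiv> weight x1 (p i) (q i)"

text \<open>
  How far a point has advanced on the way from the levels before \<open>i\<close> to those after \<open>i\<close>, measured
  within the circles of level \<open>i\<close>.
\<close>
definition depth :: "nat \<Rightarrow> nat \<times> nat \<times> int \<Rightarrow> int" where
  "depth i v = (if fst v < i then 0 else if fst v = i then circ_dist (N i) (snd (snd v)) else S i)"

abbreviation reach :: "nat \<Rightarrow> int" where
  "reach i \<equiv> \<bar>p i\<bar> + \<bar>q i\<bar>"

lemma depth_rot:
  assumes "v \<in> V" shows "depth i (rot c v) \<le> depth i v + \<bar>c i\<bar>"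
  using assms circ_dist_mod(1) by (cases v) (auto simp: depth_def V_def)

text \<open>
  Below depth \<open>S i\<close> no attachment to a level after \<open>i\<close> is met, so \<open>link\<close> either fixes the point or
  leads to a level before \<open>i\<close> or to a point \<open>0\<close> of level \<open>i\<close>, that is, to depth \<open>0\<close>.
\<close>
lemma depth_link:
  assumes "v \<in> V" "depth i v < S i" shows "depth i (link v) \<le> depth i v"
proof -
  obtain j k t where v: "v = (j, k, t)" by (cases v)
  have t: "0 \<le> t" "t < N j" using assms v by (auto simp: V_def)
  have "\<not> i < j" using assms v by (auto simp: depth_def)
  then consider "j = i" | "j < i" by linarith
  then show ?thesis
  proof cases
    case 1
    then have "\<not> (S i \<le> t \<and> t < S i + int D)"
      using assms v by (auto simp: depth_def circ_dist_def N_def)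
    then show ?thesis using v 1 t
      by (auto simp: depth_def circ_dist_def split: nat.splits)
  next
    case 2
    then show ?thesis using v N_pos[of i]
      by (auto simp: depth_def circ_dist_def split: nat.splits)
  qed
qed

lemma depth_step:
  assumes "v \<in> V" "depth i v + reach i < S i"
  shows "depth i (step a v) \<le> depth i v + reach i"
proof -
  have "depth i (link (rot (- q) v)) \<le> depth i v + \<bar>q i\<bar>"
    using depth_rot[OF assms(1), of i "- q"] depth_link[OF rot_closed[OF assms(1)], of i "- q"] assms(2)
    unfolding fun_Compl_def by linarith
  moreover have "depth i (rot q (link v)) \<le> depth i v + \<bar>q i\<bar>"
    using depth_rot[OF link_closed[OF assms(1)], of i q] depth_link[OF assms(1), of i] assms(2)
    by linarith
  ultimately show ?thesis
    using depth_rot[OF assms(1), of i p] depth_rot[OF assms(1), of i "- p"] by (auto simp: step_def)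
qed

lemma depth_fold_step:
  assumes "v \<in> V" "snd ` set w \<subseteq> {x1, x2}" "depth i v + int (length w) * reach i < S i"
  shows "depth i (fold step w v) \<le> depth i v + int (length w) * reach i"
  using assms
proof (induction w arbitrary: v)
  case (Cons a w)
  have len: "int (length (a # w)) * reach i = int (length w) * reach i + reach i"
    by (simp add: algebra_simps)
  have nn: "0 \<le> int (length w) * reach i" by simp
  have "depth i (step a v) \<le> depth i v + reach i"
    using depth_step[OF Cons.prems(1), of i a] Cons.prems(3) len nn by linarith
  moreover have "step a v \<in> V" using step_closed Cons.prems by simp
  ultimately show ?case
    using Cons.IH[of "step a v"] Cons.prems len by simp
qed simp

text \<open>
  Away from the attachment points \<open>link\<close> is the identity, and a letter merely rotates the circle.
\<close>
lemma step_inner: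
  assumes "(i, k, t) \<in> V" "reach i < circ_dist (N i) t" "circ_dist (N i) t + reach i < S i"
    "snd a \<in> {x1, x2}"
  shows "step a (i, k, t) = (i, k, (t + shift i a) mod N i)"
proof -
  have fix_inner: "link (i, k, s) = (i, k, s)" if "0 < circ_dist (N i) s" "circ_dist (N i) s < S i" for s
    using that by (auto simp: circ_dist_def N_def split: nat.splits)
  have t: "0 \<le> t" "t < N i" using assms by (auto simp: V_def)
  have "circ_dist (N i) ((t - q i) mod N i) \<le> circ_dist (N i) t + \<bar>q i\<bar>"
       "circ_dist (N i) t \<le> circ_dist (N i) ((t - q i) mod N i) + \<bar>q i\<bar>"
    using circ_dist_mod[OF t, of "- q i"] by auto
  then have "link (i, k, (t - q i) mod N i) = (i, k, (t - q i) mod N i)"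
    using assms by (intro fix_inner) auto
  moreover have "link (i, k, t) = (i, k, t)"
    using assms by (intro fix_inner) auto
  ultimately show ?thesis
    using assms(4) distinct by (auto simp: step_def weight_def simp del: link.simps)
qed

lemma fold_step_inner:
  assumes "(i, k, t) \<in> V" "snd ` set w \<subseteq> {x1, x2}"
    "int (length w) * reach i < circ_dist (N i) t"
    "circ_dist (N i) t + int (length w) * reach i < S i"
  shows "fold step w (i, k, t) = (i, k, (t + sum_list (map (shift i) w)) mod N i)"
  using assms
proof (induction w arbitrary: t)
  case Nil
  then show ?case by (auto simp: V_def)
next
  case (Cons a w)
  have len: "int (length (a # w)) * reach i = int (length w) * reach i + reach i"
    by (simp add: algebra_simps)
  have nn: "0 \<le> int (length w) * reach i" by simp
  let ?s = "(t + shift i a) mod N i"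
  have st: "step a (i, k, t) = (i, k, ?s)"
  proof (rule step_inner)
    show "(i, k, t) \<in> V" "snd a \<in> {x1, x2}" using Cons.prems by auto
    show "reach i < circ_dist (N i) t" "circ_dist (N i) t + reach i < S i"
      using Cons.prems(3,4) len nn by linarith+
  qed
  have sV: "(i, k, ?s) \<in> V"
    using step_closed[of a "(i, k, t)"] Cons.prems st by simp
  have "\<bar>shift i a\<bar> \<le> reach i" by (auto simp: weight_def)
  moreover have "0 \<le> t" "t < N i" using Cons.prems by (auto simp: V_def)
  ultimately have "circ_dist (N i) ?s \<le> circ_dist (N i) t + reach i"
     "circ_dist (N i) t \<le> circ_dist (N i) ?s + reach i"
    using circ_dist_mod[of t "N i" "shift i a"] by linarith+
  then have "fold step w (i, k, ?s) = (i, k, (?s + sum_list (map (shift i) w)) mod N i)"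
    using Cons.prems len by (intro Cons.IH sV) auto
  then show ?case using st by (simp add: mod_simps algebra_simps)
qed

text \<open>
  Let \<open>M\<close> bound the change of depth along \<open>w\<close>, and consider the points of depth at most \<open>2 * M\<close>. One
  of depth at most \<open>M\<close> ends at depth at most \<open>2 * M\<close>. One of greater depth stays clear of all
  attachment points while \<open>w\<close> is read, so it is rotated by the total weight of \<open>w\<close>, which is \<open>0\<close>:
  it is fixed. Hence this set is invariant, and it is finite.
\<close>
theorem trap:
  assumes "snd ` set w \<subseteq> {x1, x2}" "sum_list (map (shift i) w) = 0"
    "(3 * int (length w) + 3) * reach i \<le> S i"
  shows "\<exists>A. finite A \<and> (0, 0, 0) \<in> A \<and> fold step w ` A \<subseteq> A"
proof -
  define M where "M = int (length w) * reach i"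
  define A where "A = {v \<in> V. depth i v \<le> 2 * M}"
  \<comment> \<open>Coprimality makes \<open>reach i\<close> positive, hence \<open>3 * M < S i\<close> strict. For the empty word, where
    \<open>M = 0\<close>, this still keeps the points beyond level \<open>i\<close>, of depth \<open>S i\<close>, out of \<open>A\<close>.\<close>
  have "p i \<noteq> 0 \<or> q i \<noteq> 0" using coprime_pq[of i] by auto
  then have "0 < reach i" by linarith
  then have S: "3 * M < S i" "0 \<le> M"
    using assms(3) by (auto simp: M_def algebra_simps)
  have "A \<subseteq> {v \<in> V. fst v \<le> i}"
    using S by (auto simp: A_def depth_def split: if_splits)
  then have "finite A" using finite_V_upto finite_subset by blast
  moreover have "(0, 0, 0) \<in> A"
    using base S N_pos[of 0] by (auto simp: A_def depth_def circ_dist_def)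
  moreover have "fold step w v \<in> A" if "v \<in> A" for v
  proof (cases "depth i v \<le> M")
    case True
    then show ?thesis
      using depth_fold_step[OF _ assms(1), of v i] S that fold_closed[OF assms(1)]
      by (auto simp: A_def M_def[symmetric])
  next
    case False
    obtain j k t where jkt: "v = (j, k, t)" by (cases v)
    then have "j = i" using that S False by (auto simp: A_def depth_def split: if_splits)
    then have v: "v = (i, k, t)" "M < circ_dist (N i) t" "circ_dist (N i) t \<le> 2 * M" "v \<in> V"
      using that False jkt by (auto simp: A_def depth_def)
    then have "fold step w v = (i, k, t mod N i)"
      using fold_step_inner[of i k t w] assms S by (simp add: M_def[symmetric])
    then show ?thesis using that v by (auto simp: V_def)
  qed
  ultimately show ?thesis by blast
qed

end

section \<open>Choosing the traps and their levels\<close>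

text \<open>
  If the exponent sums of \<open>w\<close> are \<open>A\<close> in \<open>x\<close> and \<open>B\<close> in the other letters, not both \<open>0\<close>, then
  \<open>(B, - A)\<close>, divided by the greatest common divisor, will do.
\<close>
lemma coprime_relation:
  fixes w :: "'a letter list"
  shows "\<exists>p q :: int. coprime p q \<and>
    sum_list (map (weight x p q) w) = 0"
proof -
  define A :: int where "A = sum_list (map (\<lambda>a. if snd a = x then (if fst a then - 1 else 1) else 0) w)"
  define B :: int where "B = sum_list (map (\<lambda>a. if snd a = x then 0 else (if fst a then - 1 else 1)) w)"
  have "sum_list (map (weight x p q) w) = p * A + q * B" for p q
    unfolding A_def B_def by (induction w) (auto simp: weight_def algebra_simps)
  moreover have "\<exists>p q. coprime p q \<and> p * A + q * B = 0"
  proof (cases "A = 0 \<and> B = 0")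
    case True
    then show ?thesis by (intro exI[of _ 1] exI[of _ 0]) auto
  next
    case False
    then have "coprime (B div gcd A B) (- (A div gcd A B))"
      using div_gcd_coprime[of A B] by (auto simp: coprime_commute)
    moreover have "B div gcd A B * A = A div gcd A B * B"
      by (simp add: div_mult_swap dvd_div_mult mult.commute)
    ultimately show ?thesis by (intro exI[of _ "B div gcd A B"] exI[of _ "- (A div gcd A B)"]) auto
  qed
  ultimately show ?thesis by metis
qed

lemma infinite_right_minima:
  fixes f :: "nat \<Rightarrow> nat"
  shows "infinite {i. \<forall>k\<ge>i. f i \<le> f k}"
  unfolding infinite_nat_iff_unbounded_le
proof
  fix m
  obtain n where n: "m \<le> n" "\<And>k. m \<le> k \<Longrightarrow> f n \<le> f k"
    using ex_has_least_nat[of "\<lambda>i. m \<le> i" m f] by auto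
  then show "\<exists>n\<ge>m. n \<in> {i. \<forall>k\<ge>i. f i \<le> f k}" by (intro exI[of _ n]) auto
qed

text \<open>
  The option \<open>J i\<close> tells which task, if any, is carried out at position \<open>i\<close>; task \<open>j\<close> has cost \<open>s j\<close>.
  As \<open>G\<close> is infinite, each task can wait for a position that exceeds the cost of all tasks up to
  it, and then the total cost incurred up to \<open>n\<close> never exceeds \<open>n\<close>.
\<close>
lemma sparse_placement:
  fixes s :: "nat \<Rightarrow> nat" and G :: "nat set"
  assumes "infinite G"
  obtains J :: "nat \<Rightarrow> nat option" where
    "\<And>j. \<exists>i. J i = Some j"
    "\<And>i. J i \<noteq> None \<Longrightarrow> i \<in> G"
    "\<And>i. J i = None \<or> J (Suc i) = None"
    "\<And>n. (\<Sum>i\<le>n. case J i of None \<Rightarrow> 0 | Some j \<Rightarrow> s j) \<le> n"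
proof -
  let ?P = "\<lambda>j x. x \<in> G \<and> (\<Sum>l\<le>j. s l) \<le> x"
  have "\<exists>x\<in>G. m \<le> x" for m using assms by (auto simp: infinite_nat_iff_unbounded_le)
  then have "\<exists>y. ?P j y \<and> x + 2 \<le> y" for j x :: nat
    by (metis (no_types, opaque_lifting) max.bounded_iff)
  then obtain place where place: "\<And>j. ?P j (place j)" "\<And>j. place j + 2 \<le> place (Suc j)"
    using dependent_nat_choice[of ?P "\<lambda>_ x y. x + 2 \<le> y"] by blast
  have mono: "strict_mono place"
    using place(2) by (intro strict_mono_Suc_iff[THEN iffD2] allI) (metis add_2_eq_Suc' Suc_le_lessD Suc_leD)
  then have inj: "inj place" by (rule strict_mono_imp_inj_on)
  define J where "J i = (if i \<in> range place then Some (inv_into UNIV place i) else None)" for i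
  have J: "J (place j) = Some j" for j using inj by (simp add: J_def)
  have gap: "place j' \<noteq> Suc (place j)" for j j'
  proof
    assume eq: "place j' = Suc (place j)"
    then have "j < j'" using mono by (metis lessI strict_mono_less)
    then have "place (Suc j) \<le> place j'" using mono by (simp add: strict_mono_less_eq)
    then show False using place(2)[of j] eq by simp
  qed
  show thesis
  proof (rule that[of J])
    show "\<exists>i. J i = Some j" for j using J by blast
    show "J i \<noteq> None \<Longrightarrow> i \<in> G" for i using place(1) by (auto simp: J_def split: if_splits)
    show "J i = None \<or> J (Suc i) = None" for i
      using gap by (auto simp: J_def) metis
  next
    fix n
    define B where "B = {j. place j \<le> n}"
    have "j \<le> place j" for j using mono strict_mono_imp_increasing by blast
    then have "B \<subseteq> {..n}" unfolding B_def by (auto intro: le_trans)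
    then have fin: "finite B" using finite_subset by blast
    have "(\<Sum>i\<le>n. case J i of None \<Rightarrow> 0 | Some j \<Rightarrow> s j)
        = (\<Sum>i\<in>place ` B. case J i of None \<Rightarrow> 0 | Some j \<Rightarrow> s j)"
      by (intro sum.mono_neutral_right) (auto simp: B_def J_def)
    also have "\<dots> = (\<Sum>j\<in>B. s j)"
      using inj by (subst sum.reindex) (auto simp: J inj_on_def)
    also have "\<dots> \<le> n"
    proof (cases "B = {}")
      case False
      then have "Max B \<in> B" using fin by simp
      moreover have "(\<Sum>j\<in>B. s j) \<le> (\<Sum>j\<le>Max B. s j)"
        using fin by (intro sum_mono2) auto
      ultimately show ?thesis using place(1)[of "Max B"] by (simp add: B_def)
    qed simp
    finally show "(\<Sum>i\<le>n. case J i of None \<Rightarrow> 0 | Some j \<Rightarrow> s j) \<le> n" .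
  qed
qed

section \<open>Realising a growth function\<close>

text \<open>
  Most levels get \<open>p = 1\<close>, \<open>q = 0\<close> and circles of \<open>3 * D\<close> points, and the number \<open>h i\<close> of circles is
  \<open>f i / (3 * D)\<close> rounded up. So the balls contain too many points for two reasons: the rounding,
  and the long circles of the trap levels. The excess at radius \<open>n\<close> cannot be absorbed by a
  constant factor, and is compared with the values of \<open>f\<close> beyond \<open>n\<close> instead. Rounding costs
  at most \<open>3 * D\<close> on each level, which the levels from \<open>2 * n\<close> to a larger multiple of \<open>n\<close> pay for,
  as \<open>f \<ge> 1\<close>. The trap levels \<open>i\<close> satisfy \<open>f i \<le> f k\<close> for all \<open>k \<ge> i\<close> and have total circle length
  at most \<open>n\<close> up to level \<open>n\<close>, so that the levels between \<open>n\<close> and \<open>2 * n\<close> pay for them.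
\<close>
lemma realise_infinite:
  fixes x1 x2 :: 'a and f :: "nat \<Rightarrow> nat"
  assumes ne: "x1 \<noteq> x2" and f0: "f 0 = 1" and pos: "\<And>i. 0 < f i"
    and D: "0 < D" "\<And>i. f (Suc i) \<le> D * f i"
  shows "\<exists>H. essential_subgroup H (free_group {x1, x2}) \<and>
    growth_equiv (cogrowth (free_group {x1, x2}) (free_gen ` {x1, x2}) H) (\<lambda>n. \<Sum>i\<le>n. f i)"
proof -
  define W where "W = lists (UNIV \<times> {x1, x2} :: 'a letter set)"
  have "countable W" unfolding W_def by (intro countable_lists) auto
  moreover have "[] \<in> W" by (simp add: W_def)
  ultimately have enum: "range (from_nat_into W) = W"
    by (intro range_from_nat_into) auto
  have "\<forall>j. \<exists>p q :: int. coprime p q \<and> sum_list (map (weight x1 p q) (from_nat_into W j)) = 0"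
    by (intro allI coprime_relation)
  then obtain p' q' :: "nat \<Rightarrow> int" where pq: "\<And>j. coprime (p' j) (q' j)"
    "\<And>j. sum_list (map (weight x1 (p' j) (q' j)) (from_nat_into W j)) = 0"
    unfolding choice_iff by blast
  define S' where "S' j = (3 * int (length (from_nat_into W j)) + 3) * (\<bar>p' j\<bar> + \<bar>q' j\<bar>) + int D" for j
  obtain J where J: "\<And>j. \<exists>i. J i = Some j"
    "\<And>i. J i \<noteq> None \<Longrightarrow> i \<in> {i. \<forall>k\<ge>i. f i \<le> f k}"
    "\<And>i. J i = None \<or> J (Suc i) = None"
    "\<And>n. (\<Sum>i\<le>n. case J i of None \<Rightarrow> 0 | Some j \<Rightarrow> nat (3 * (2 * S' j + int D))) \<le> n"
    using sparse_placement[OF infinite_right_minima[of f], of "\<lambda>j. nat (3 * (2 * S' j + int D))"]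
    by blast
  \<comment> \<open>The cost \<open>3 * N\<close> of a trap pays both for its points and, by \<open>circle_ball\<close>, for the steps
    that crossing its circle may take.\<close>
  define c where "c i = (case J i of None \<Rightarrow> 0 | Some j \<Rightarrow> nat (3 * (2 * S' j + int D)))" for i
  define p where "p i = (case J i of None \<Rightarrow> 1 | Some j \<Rightarrow> p' j)" for i
  define q where "q i = (case J i of None \<Rightarrow> 0 | Some j \<Rightarrow> q' j)" for i
  define S where "S i = (case J i of None \<Rightarrow> int D | Some j \<Rightarrow> S' j)" for i
  define h where "h i = (f i + (3 * D - 1)) div (3 * D)" for i
  have h_lower: "f i \<le> 3 * D * h i" and h_upper: "3 * D * h i \<le> f i + 3 * D" for i
  proof -
    have "3 * D * h i + (f i + (3 * D - 1)) mod (3 * D) = f i + (3 * D - 1)" by (simp add: h_def)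
    moreover have "(f i + (3 * D - 1)) mod (3 * D) < 3 * D" using D by simp
    ultimately show "f i \<le> 3 * D * h i" "3 * D * h i \<le> f i + 3 * D" using D by linarith+
  qed
  have h_least: "h i \<le> m" if "f i \<le> 3 * D * m" for i m
  proof -
    have "f i + (3 * D - 1) < 3 * D * Suc m" using that D by simp
    then have "h i < Suc m" unfolding h_def by (simp add: less_mult_imp_div_less mult.commute)
    then show ?thesis by simp
  qed
  interpret circle_tree x1 x2 h D p q S
  proof
    show "h 0 = 1" using h_least[of 0 1] h_lower[of 0] f0 D by (cases "h 0") auto
    show "h (Suc i) \<le> D * h i" for i
    proof (rule h_least)
      have "f (Suc i) \<le> D * f i" by (rule D)
      also have "\<dots> \<le> D * (3 * D * h i)" using h_lower by simp
      finally show "f (Suc i) \<le> 3 * D * (D * h i)" by (simp add: algebra_simps)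
    qed
    show "int D \<le> S i" for i
      by (auto simp: S_def S'_def split: option.split)
    show "coprime (p i) (q i)" for i
      using pq by (auto simp: p_def q_def split: option.split)
    show "q i = 0 \<or> q (Suc i) = 0" for i
      using J(3)[of i] by (auto simp: q_def)
  qed (use ne D in auto)
  let ?\<Gamma> = "cogrowth F (free_gen ` {x1, x2}) stab" and ?\<alpha> = "\<lambda>n. \<Sum>i\<le>n. f i"
  have "essential_subgroup stab F"
  proof (rule essential_stab)
    fix w assume "w \<in> carrier F"
    then have w: "snd ` set w \<subseteq> {x1, x2}" by (simp add: free_group_def)
    then have "w \<in> W" by (auto simp: W_def)
    then obtain j where j: "from_nat_into W j = w" using enum by (metis rangeE)
    obtain i where i: "J i = Some j" using J(1) by blast
    show "\<exists>A. finite A \<and> (0, 0, 0) \<in> A \<and> fold step w ` A \<subseteq> A"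
    proof (rule trap[OF w])
      show "sum_list (map (shift i) w) = 0"
        using pq(2)[of j] i j by (simp add: p_def q_def)
      show "(3 * int (length w) + 3) * reach i \<le> S i"
        using i j by (simp add: S_def S'_def p_def q_def)
    qed
  qed
  moreover have "growth_equiv ?\<Gamma> ?\<alpha>"
    unfolding growth_equiv_def
  proof (intro exI[of _ "18 * D + 2"] conjI allI)
    fix n
    let ?C = "18 * D + 2"
    have c_sum: "(\<Sum>i\<le>n. c i) \<le> n" unfolding c_def by (rule J)
    have N_le: "nat (N i) \<le> 3 * D + c i" "nat (3 * N i) \<le> 9 * D + c i" "3 * D \<le> nat (N i)" for i
      using D_le_S[of i] by (auto simp: N_def S_def c_def split: option.split)
    show "?\<Gamma> n \<le> ?\<alpha> (?C * n)"
    proof (cases "n = 0")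
      case True
      then show ?thesis using cogrowth_stab_0 f0 by simp
    next
      case False
      have small: "h i * c i \<le> c i * f k" if "i \<le> k" for i k
      proof (cases "J i")
        case (Some j)
        have "f i \<le> 3 * D * f i" using D by simp
        then have "h i \<le> f i" by (rule h_least)
        also have "f i \<le> f k" using J(2)[of i] Some that by auto
        finally show ?thesis by (simp add: mult.commute)
      qed (simp add: c_def)
      \<comment> \<open>On each of the \<open>n\<close> levels after \<open>n\<close>, \<open>f\<close> is at least as large as on any trap level up to \<open>n\<close>.\<close>
      have "(\<Sum>i\<le>n. h i * c i) \<le> (\<Sum>k\<in>{n<..2*n}. f k)"
      proof -
        obtain k where k: "k \<in> {n<..2*n}" "\<And>l. l \<in> {n<..2*n} \<Longrightarrow> f k \<le> f l"
          using ex_has_least_nat[of "\<lambda>k. k \<in> {n<..2*n}" "2 * n" f] False by auto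
        have "(\<Sum>i\<le>n. h i * c i) \<le> (\<Sum>i\<le>n. c i * f k)"
          using k by (intro sum_mono small) auto
        also have "\<dots> \<le> n * f k" using c_sum by (simp flip: sum_distrib_right)
        also have "\<dots> = (\<Sum>l\<in>{n<..2*n}. f k)" by simp
        also have "\<dots> \<le> (\<Sum>l\<in>{n<..2*n}. f l)" using k by (intro sum_mono) auto
        finally show ?thesis .
      qed
      moreover have "(\<Sum>i\<le>n. h i * (3 * D)) \<le> ?\<alpha> n + 6 * D * n"
      proof -
        have "(\<Sum>i\<le>n. h i * (3 * D)) \<le> (\<Sum>i\<le>n. f i + 3 * D)"
          using h_upper by (intro sum_mono) (simp add: mult.commute)
        also have "\<dots> = ?\<alpha> n + 3 * D * (n + 1)" by (simp add: sum.distrib)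
        also have "3 * D * (n + 1) \<le> 6 * D * n" using False by (cases n) auto
        finally show ?thesis by simp
      qed
      moreover have "6 * D * n \<le> (\<Sum>k\<in>{2*n<..?C*n}. f k)"
      proof -
        have "(\<Sum>k\<in>{2*n<..?C*n}. 1) \<le> (\<Sum>k\<in>{2*n<..?C*n}. f k)"
          using pos by (intro sum_mono) (simp add: Suc_leI)
        then show ?thesis by (simp add: algebra_simps)
      qed
      moreover have "?\<alpha> (?C * n) = ?\<alpha> n + (\<Sum>k\<in>{n<..2*n}. f k) + (\<Sum>k\<in>{2*n<..?C*n}. f k)"
      proof -
        have "{..?C*n} = {..n} \<union> {n<..2*n} \<union> {2*n<..?C*n}" by auto
        then show ?thesis by (simp only:) (subst sum.union_disjoint; auto)+
      qed
      moreover have "(\<Sum>i\<le>n. h i * nat (N i)) \<le> (\<Sum>i\<le>n. h i * (3 * D)) + (\<Sum>i\<le>n. h i * c i)"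
        unfolding sum.distrib[symmetric] distrib_left[symmetric]
        using N_le(1) by (intro sum_mono mult_left_mono) auto
      ultimately show ?thesis using cogrowth_le[of n] by linarith
    qed
    show "?\<alpha> n \<le> ?\<Gamma> (?C * n)"
    proof (cases "n = 0")
      case True
      then show ?thesis using cogrowth_stab_0 f0 by simp
    next
      case False
      have "?\<alpha> n \<le> (\<Sum>i\<le>n. h i * nat (N i))"
      proof (rule sum_mono)
        fix i
        have "f i \<le> h i * (3 * D)" using h_lower by (simp add: mult.commute)
        also have "\<dots> \<le> h i * nat (N i)" using N_le(3) by simp
        finally show "f i \<le> h i * nat (N i)" .
      qed
      also have "\<dots> \<le> ?\<Gamma> (?C * n)"
      proof (rule cogrowth_ge)
        have "(\<Sum>l\<le>n. nat (3 * N l)) \<le> (\<Sum>l\<le>n. 9 * D + c l)"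
          using N_le(2) by (intro sum_mono) auto
        also have "\<dots> \<le> 9 * D * (n + 1) + n" using c_sum by (simp add: sum.distrib)
        also have "\<dots> \<le> ?C * n" using False by (cases n) (auto simp: algebra_simps)
        finally show "(\<Sum>l\<le>n. nat (3 * N l)) \<le> ?C * n" .
      qed
      finally show ?thesis .
    qed
  qed simp
  ultimately show ?thesis by blast
qed

text \<open>
  Let the first generator rotate the residues modulo the final value \<open>T\<close> of the growth function,
  and the second act trivially. Both growth functions are \<open>1\<close> at \<open>0\<close> and reach \<open>T\<close>, so they are
  equivalent.
\<close>
lemma realise_finite:
  fixes x1 x2 :: 'a and f :: "nat \<Rightarrow> nat"
  assumes f0: "f 0 = 1" and zero: "\<And>i. r < i \<Longrightarrow> f i = 0"
  shows "\<exists>H. essential_subgroup H (free_group {x1, x2}) \<and>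
    growth_equiv (cogrowth (free_group {x1, x2}) (free_gen ` {x1, x2}) H) (\<lambda>n. \<Sum>i\<le>n. f i)"
proof -
  let ?\<alpha> = "\<lambda>n. \<Sum>i\<le>n. f i"
  define T where "T = ?\<alpha> r"
  have \<alpha>_le: "?\<alpha> n \<le> T" and \<alpha>_eq: "r \<le> n \<Longrightarrow> ?\<alpha> n = T" for n
  proof -
    show eq: "?\<alpha> n = T" if "r \<le> n" for n
      unfolding T_def using that zero by (intro sum.mono_neutral_right) auto
    have "?\<alpha> n \<le> ?\<alpha> (max n r)" by (intro sum_mono2) auto
    then show "?\<alpha> n \<le> T" using eq[of "max n r"] by simp
  qed
  have "f 0 \<le> T" unfolding T_def by (intro member_le_sum) auto
  then have T: "0 < T" using f0 by simp
  define st :: "'a letter \<Rightarrow> int \<Rightarrow> int" where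
    "st a v = (if snd a = x1 then (v + (if fst a then - 1 else 1)) mod int T else v)" for a v
  interpret letter_action "{x1, x2}" "{0..<int T}" st 0
    by unfold_locales (use T in \<open>auto simp: st_def inv_letter_def mod_simps\<close>)
  have sub: "ball n \<subseteq> {0..<int T}" for n
    using fold_closed base by (auto simp: ball_def)
  have eq: "ball n = {0..<int T}" if "T \<le> n" for n
  proof (intro equalityI sub subsetI)
    fix v assume v: "v \<in> {0..<int T}"
    have "fold st (replicate m (False, x1)) 0 = int m mod int T" for m
      by (induction m) (simp_all add: st_def mod_simps add.commute flip: replicate_append_same)
    from this[of "nat v"] have "v = fold st (replicate (nat v) (False, x1)) 0" using v by simp
    then show "v \<in> ball n" using v that unfolding ball_def
      by (intro CollectI exI[of _ "replicate (nat v) (False, x1)"]) auto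
  qed
  have "essential_subgroup stab F"
    using fold_closed base
    by (intro essential_stab exI[of _ "{0..<int T}"]) (auto simp: free_group_def)
  moreover have "growth_equiv (cogrowth F (free_gen ` {x1, x2}) stab) ?\<alpha>"
    unfolding growth_equiv_def
  proof (intro exI[of _ "T + r"] conjI allI)
    fix n
    have big: "T \<le> (T + r) * n" "r \<le> (T + r) * n" if "n \<noteq> 0"
      using that by (cases n; simp)+
    have "card (ball n) \<le> T" using card_mono[OF _ sub[of n]] by simp
    then show "cogrowth F (free_gen ` {x1, x2}) stab n \<le> ?\<alpha> ((T + r) * n)"
      using cogrowth_stab_0 f0 \<alpha>_eq big unfolding cogrowth_stab by (cases "n = 0") simp_all
    show "?\<alpha> n \<le> cogrowth F (free_gen ` {x1, x2}) stab ((T + r) * n)"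
      using cogrowth_stab_0 f0 \<alpha>_le[of n] eq big
      unfolding cogrowth_stab by (cases "n = 0") simp_all
  qed (use T in simp)
  ultimately show ?thesis by blast
qed

theorem theorem1p2:
  fixes x\<^sub>1 x\<^sub>2 :: 'a and \<alpha> :: "nat \<Rightarrow> nat"
  assumes "x\<^sub>1 \<noteq> x\<^sub>2"
    and "\<alpha> \<in> CG"
  shows "\<exists>H. essential_subgroup H (free_group {x\<^sub>1, x\<^sub>2}) \<and>
    growth_equiv (cogrowth (free_group {x\<^sub>1, x\<^sub>2}) (free_gen ` {x\<^sub>1, x\<^sub>2}) H) \<alpha>"
proof -
  obtain f r and d :: real where f0: "f 0 = 1"
    and r: "\<And>i. (r < enat i \<longrightarrow> f i = 0) \<and> (enat i \<le> r \<longrightarrow> 0 < f i)"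
    and d: "0 < d" "\<And>i. real (f (Suc i)) \<le> d * real (f i)"
    and \<alpha>': "\<And>n. \<alpha> n = (\<Sum>i=0..n. f i)"
    using assms(2) unfolding CG_def by blast
  have \<alpha>: "\<alpha> = (\<lambda>n. \<Sum>i\<le>n. f i)" by (auto simp: \<alpha>' atMost_atLeast0)
  show ?thesis
  proof (cases r)
    case (enat m)
    then show ?thesis unfolding \<alpha> using f0 r by (intro realise_finite[of f m]) auto
  next
    case infinity
    have "f (Suc i) \<le> nat \<lceil>d\<rceil> * f i" for i
    proof -
      have "real (f (Suc i)) \<le> d * real (f i)" by (rule d)
      also have "\<dots> \<le> real (nat \<lceil>d\<rceil>) * real (f i)" by (intro mult_right_mono) linarith+
      finally show ?thesis by (simp only: of_nat_mult[symmetric] of_nat_le_iff)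
    qed
    then show ?thesis
      unfolding \<alpha> using f0 r infinity assms(1) d(1) by (intro realise_infinite[of _ _ f "nat \<lceil>d\<rceil>"]) auto
  qed
qed

end
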